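(* Let $n\ge 2$ be an integer and let $T_n$ be the $n$-trapezohedral graph. Then the plus graph $T_n^+$ is connected if and only if $n \not\equiv 0 \pmod 3$.
   Context: The $n$-trapezohedral graph $T_n$ is the graph on $2n+2$ vertices $a_0,\dots,a_{n-1},b_0,\dots,b_{n-1},\alpha,\beta$ whose edges are those of the cycle $(a_0,b_0,a_1,b_1,\dots,a_{n-1},b_{n-1},a_0)$ together with the edges from $\alpha$ to each $a_i$ and from $\beta$ to each $b_i$ (so $N(\alpha)=\{a_0,\dots,a_{n-1}\}$, $N(\beta)=\{b_0,\dots,b_{n-1}\}$). For a graph $G$, its plus graph $G^+$ has one vertex $e^+$ for each edge $e$ of $G$, and $e^+f^+$ is an edge of $G^+$ if and only if $\{e,f\}$ is a perfect matching of some 4-cycle of $G$ (i.e. $e$ and $f$ are two non-incident edges of a common 4-cycle in $G$). *)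

theory Defs
  imports "HOL-Number_Theory.Cong" "Graph_Theory.Graph_Theory"
begin

text \<open>
  Simple undirected graphs are represented as in the locale \<^locale>\<open>pair_graph\<close>: finite, loop-free
  and symmetric sets of arcs. An undirected edge is the two-element set of its end vertices.
\<close>

definition arcs_edges :: "('a \<times> 'a) set \<Rightarrow> 'a set set" where
  "arcs_edges R = {{u, v} | u v. (u, v) \<in> R}"

definition edges :: "'a pair_pre_digraph \<Rightarrow> 'a set set" where
  "edges G = arcs_edges (parcs G)"

definition is_4_cycle :: "'a pair_pre_digraph \<Rightarrow> ('a \<times> 'a) list \<Rightarrow> bool" where
  "is_4_cycle G p \<longleftrightarrow> pre_digraph.cycle (with_proj G) p \<and> length p = 4"

text \<open>
  Two edges of a 4-cycle form a perfect matching of it iff they are non-incident, i.e. disjoint as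
  sets. The relation is symmetric, so the plus graph again has a symmetric set of arcs.
\<close>

definition plus_graph :: "'a pair_pre_digraph \<Rightarrow> 'a set pair_pre_digraph" where
  "plus_graph G =
    \<lparr> pverts = edges G,
      parcs = {(e, f). \<exists>p. is_4_cycle G p \<and> e \<in> arcs_edges (set p) \<and> f \<in> arcs_edges (set p)
        \<and> e \<inter> f = {}} \<rparr>"

datatype trapezohedral_vertex = A nat | B nat | Alpha | Beta

definition trapezohedral_arcs :: "nat \<Rightarrow> (trapezohedral_vertex \<times> trapezohedral_vertex) set" where
  "trapezohedral_arcs n =
    (\<Union>i<n. {(A i, B i), (B i, A (Suc i mod n)), (Alpha, A i), (Beta, B i)})"

definition trapezohedral_graph :: "nat \<Rightarrow> trapezohedral_vertex pair_pre_digraph" where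
  "trapezohedral_graph n =
    \<lparr> pverts = A ` {..<n} \<union> B ` {..<n} \<union> {Alpha, Beta},
      parcs = trapezohedral_arcs n \<union> (trapezohedral_arcs n)\<inverse> \<rparr>"

lemma pair_graph_trapezohedral_graph: "pair_graph (trapezohedral_graph n)"
proof
  show "finite (parcs (trapezohedral_graph n))"
    by (auto simp: trapezohedral_graph_def trapezohedral_arcs_def)
  show "symmetric (with_proj (trapezohedral_graph n))"
    by (auto simp: symmetric_def sym_def trapezohedral_graph_def)
qed (auto simp: trapezohedral_graph_def trapezohedral_arcs_def)

lemma pair_graph_plus_graph:
  assumes "pair_graph G"
  shows "pair_graph (plus_graph G)"
proof -
  interpret G: pair_graph G by fact
  have sub: "arcs_edges (set p) \<subseteq> edges G" if "is_4_cycle G p" for p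
    using that by (fastforce simp: is_4_cycle_def G.cycle_def G.awalk_def edges_def arcs_edges_def)
  have "edges G = (\<lambda>(u, v). {u, v}) ` parcs G"
    by (auto simp: edges_def arcs_edges_def)
  then have fin: "finite (edges G)"
    using G.pair_finite_arcs by simp
  show ?thesis
  proof
    have "parcs (plus_graph G) \<subseteq> edges G \<times> edges G"
      using sub by (auto simp: plus_graph_def)
    then show "finite (parcs (plus_graph G))"
      using fin finite_subset by blast
    show "symmetric (with_proj (plus_graph G))"
      by (auto simp: symmetric_def sym_def plus_graph_def)
    show "fst e \<noteq> snd e" if "e \<in> parcs (plus_graph G)" for e
      using that by (auto simp: plus_graph_def arcs_edges_def)
  qed (use fin in \<open>auto simp: plus_graph_def dest: subsetD[OF sub]\<close>)
qed

end

theory Submission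
  imports Defs
begin

text \<open>
  Write the rim cycle as \<open>x\<^sub>0, x\<^sub>1, \<dots>\<close> with indices modulo \<open>2n\<close>, and let \<open>c\<^sub>k\<close> be the rim edge
  \<open>x\<^sub>k x\<^sub>k\<^sub>+\<^sub>1\<close> and \<open>s\<^sub>k\<close> the spoke at \<open>x\<^sub>k\<close>. The quadrilateral formed by \<open>x\<^sub>k, x\<^sub>k\<^sub>+\<^sub>1, x\<^sub>k\<^sub>+\<^sub>2\<close> and their
  pole makes \<open>s\<^sub>k\<close> adjacent to \<open>c\<^sub>k\<^sub>+\<^sub>1\<close> and \<open>c\<^sub>k\<close> adjacent to \<open>s\<^sub>k\<^sub>+\<^sub>2\<close> in the plus graph, so \<open>c\<^sub>k\<close> is
  linked to \<open>c\<^sub>k\<^sub>+\<^sub>3\<close>. If 3 does not divide \<open>n\<close>, steps of length 3 reach every index modulo \<open>2n\<close>.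
  If 3 divides \<open>n\<close>, then \<open>n \<ge> 3\<close>, these quadrilaterals are the only 4-cycles, and an index modulo 3
  is constant on the components.
\<close>

section \<open>Opposite edges of 4-cycles\<close>

lemma is_4_cycle_iff:
  assumes "pair_wf_digraph G"
  shows "is_4_cycle G p \<longleftrightarrow> (\<exists>u v w x. p = [(u, v), (v, w), (w, x), (x, u)] \<and>
    distinct [u, v, w, x] \<and> {(u, v), (v, w), (w, x), (x, u)} \<subseteq> parcs G)"
proof -
  interpret pair_wf_digraph G by fact
  show ?thesis
  proof
    assume "is_4_cycle G p"
    then obtain u where u: "awalk u p u" "distinct (tl (awalk_verts u p))" "length p = 4"
      by (auto simp: is_4_cycle_def cycle_def)
    from u(3) obtain e1 e2 e3 e4 where "p = [e1, e2, e3, e4]"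
      by (auto simp: numeral_eq_Suc length_Suc_conv)
    then show "\<exists>u v w x. p = [(u, v), (v, w), (w, x), (x, u)] \<and>
        distinct [u, v, w, x] \<and> {(u, v), (v, w), (w, x), (x, u)} \<subseteq> parcs G"
      using u by (cases e1; cases e2; cases e3; cases e4) (auto simp: awalk_Cons_iff awalk_Nil_iff)
  next
    assume "\<exists>u v w x. p = [(u, v), (v, w), (w, x), (x, u)] \<and>
        distinct [u, v, w, x] \<and> {(u, v), (v, w), (w, x), (x, u)} \<subseteq> parcs G"
    then show "is_4_cycle G p"
      by (auto simp: is_4_cycle_def cycle_def awalk_Cons_iff awalk_Nil_iff dest: in_arcsD1 in_arcsD2)
  qed
qed

text \<open>Rotating a 4-cycle gives a 4-cycle, so \<open>e\<close> may be taken as its first edge;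
  its only disjoint partner is then the third.\<close>

lemma parcs_plus_graph_iff:
  assumes "pair_wf_digraph G"
  shows "(e, f) \<in> parcs (plus_graph G) \<longleftrightarrow> (\<exists>u v w x. e = {u, v} \<and> f = {w, x} \<and>
    distinct [u, v, w, x] \<and> {(u, v), (v, w), (w, x), (x, u)} \<subseteq> parcs G)"
  (is "_ \<longleftrightarrow> ?R")
proof
  assume "(e, f) \<in> parcs (plus_graph G)"
  then obtain u v w x where *: "distinct [u, v, w, x]"
      "{(u, v), (v, w), (w, x), (x, u)} \<subseteq> parcs G" "e \<inter> f = {}"
      "e \<in> arcs_edges {(u, v), (v, w), (w, x), (x, u)}"
      "f \<in> arcs_edges {(u, v), (v, w), (w, x), (x, u)}"
    by (auto simp: plus_graph_def is_4_cycle_iff[OF assms])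
  have R: ?R if "e = {u, v}" "f = {w, x}" "distinct [u, v, w, x]"
      "{(u, v), (v, w), (w, x), (x, u)} \<subseteq> parcs G" for u v w x
    using that by blast
  have "arcs_edges {(u, v), (v, w), (w, x), (x, u)} = {{u, v}, {v, w}, {w, x}, {x, u}}"
    unfolding arcs_edges_def by blast
  with *(4,5) have "e = {u, v} \<or> e = {v, w} \<or> e = {w, x} \<or> e = {x, u}"
      "f = {u, v} \<or> f = {v, w} \<or> f = {w, x} \<or> f = {x, u}"
    by simp_all
  then have "e = {u, v} \<and> f = {w, x} \<or> e = {v, w} \<and> f = {x, u} \<or>
      e = {w, x} \<and> f = {u, v} \<or> e = {x, u} \<and> f = {v, w}"
    using *(3) by (elim disjE; simp)
  then show ?R
  proof (elim disjE conjE)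
    assume "e = {u, v}" "f = {w, x}"
    then show ?R using *(1,2) by (rule R)
  next
    assume "e = {v, w}" "f = {x, u}"
    then show ?R by (rule R) (use *(1,2) in auto)
  next
    assume "e = {w, x}" "f = {u, v}"
    then show ?R by (rule R) (use *(1,2) in auto)
  next
    assume "e = {x, u}" "f = {v, w}"
    then show ?R by (rule R) (use *(1,2) in auto)
  qed
next
  assume ?R
  then obtain u v w x where *: "e = {u, v}" "f = {w, x}" "distinct [u, v, w, x]"
      "{(u, v), (v, w), (w, x), (x, u)} \<subseteq> parcs G"
    by blast
  then have "is_4_cycle G [(u, v), (v, w), (w, x), (x, u)]"
    unfolding is_4_cycle_iff[OF assms] by blast
  moreover have "e \<in> arcs_edges (set [(u, v), (v, w), (w, x), (x, u)])"
      "f \<in> arcs_edges (set [(u, v), (v, w), (w, x), (x, u)])" "e \<inter> f = {}"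
    using * by (auto simp: arcs_edges_def)
  ultimately show "(e, f) \<in> parcs (plus_graph G)"
    unfolding plus_graph_def by auto
qed

section \<open>Cyclic indexing of rim edges and spokes\<close>

definition rim :: "nat \<Rightarrow> nat \<Rightarrow> trapezohedral_vertex" where
  "rim n k = (if even k then A (k div 2 mod n) else B (k div 2 mod n))"

definition pole :: "nat \<Rightarrow> trapezohedral_vertex" where
  "pole k = (if even k then Alpha else Beta)"

definition rim_edge :: "nat \<Rightarrow> nat \<Rightarrow> trapezohedral_vertex set" where
  "rim_edge n k = {rim n k, rim n (Suc k)}"

definition spoke :: "nat \<Rightarrow> nat \<Rightarrow> trapezohedral_vertex set" where
  "spoke n k = {pole k, rim n k}"

text \<open>The residue of \<open>k\<close> modulo \<open>2 * n\<close> determines both the parity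
  of \<open>k\<close> and \<open>k div 2 mod n\<close>. Indices can thus run through all naturals
  without wrap-around cases.\<close>

lemma rim_eqI: "[k = l] (mod 2 * n) \<Longrightarrow> rim n k = rim n l"
proof -
  assume "[k = l] (mod 2 * n)"
  then have "k mod (2 * n) = l mod (2 * n)" by (simp add: cong_def)
  moreover have "i div 2 mod n = i mod (2 * n) div 2" "i mod 2 = i mod (2 * n) mod 2" for i
    by (simp_all add: mod_mult2_eq mod_mod_cancel)
  ultimately have "k mod 2 = l mod 2" "k div 2 mod n = l div 2 mod n"
    by metis+
  then show ?thesis by (simp add: rim_def even_iff_mod_2_eq_zero)
qed

lemma rim_edge_eqI: "[k = l] (mod 2 * n) \<Longrightarrow> rim_edge n k = rim_edge n l"
  unfolding rim_edge_def Suc_eq_plus1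
  by (intro arg_cong2[of _ _ _ _ "\<lambda>x y. {x, y}"] rim_eqI cong_add cong_refl)

lemma rim_arc:
  assumes "n > 0"
  shows "(rim n k, rim n (Suc k)) \<in> parcs (trapezohedral_graph n)"
    "(rim n (Suc k), rim n k) \<in> parcs (trapezohedral_graph n)"
proof -
  have "(rim n k, rim n (Suc k)) \<in> trapezohedral_arcs n"
    using assms by (cases "even k")
      (auto simp: rim_def trapezohedral_arcs_def mod_Suc_eq elim!: oddE intro!: bexI[of _ "k div 2 mod n"])
  then show "(rim n k, rim n (Suc k)) \<in> parcs (trapezohedral_graph n)"
    "(rim n (Suc k), rim n k) \<in> parcs (trapezohedral_graph n)"
    by (auto simp: trapezohedral_graph_def)
qed

lemma spoke_arc:
  assumes "n > 0"
  shows "(pole k, rim n k) \<in> parcs (trapezohedral_graph n)"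
    "(rim n k, pole k) \<in> parcs (trapezohedral_graph n)"
  using assms by (auto simp: trapezohedral_graph_def trapezohedral_arcs_def pole_def rim_def)

text \<open>The two outer rim vertices have the same type and indices consecutive modulo
  \<open>n\<close>; \<open>n \<ge> 2\<close> keeps these apart.\<close>

lemma rim_distinct:
  assumes "n \<ge> 2"
  shows "distinct [pole k, rim n k, rim n (Suc k), rim n (Suc (Suc k))]"
proof -
  have "Suc i mod n \<noteq> i mod n" for i
    using assms by (simp add: mod_Suc)
  then show ?thesis
    by (auto simp: pole_def rim_def) metis+
qed

lemma edges_trapezohedral_graph:
  assumes "n > 0"
  shows "edges (trapezohedral_graph n) = range (rim_edge n) \<union> range (spoke n)"
proof (intro equalityI subsetI)
  fix e assume "e \<in> edges (trapezohedral_graph n)"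
  then obtain u v where "e = {u, v}" "(u, v) \<in> trapezohedral_arcs n"
    by (auto simp: edges_def arcs_edges_def trapezohedral_graph_def insert_commute)
  then obtain i where "i < n" "e = {A i, B i} \<or> e = {B i, A (Suc i mod n)} \<or>
      e = {Alpha, A i} \<or> e = {Beta, B i}"
    by (auto simp: trapezohedral_arcs_def)
  then have "e = rim_edge n (2 * i) \<or> e = rim_edge n (2 * i + 1) \<or>
      e = spoke n (2 * i) \<or> e = spoke n (2 * i + 1)"
    by (auto simp: rim_edge_def spoke_def rim_def pole_def)
  then show "e \<in> range (rim_edge n) \<union> range (spoke n)" by blast
next
  fix e assume "e \<in> range (rim_edge n) \<union> range (spoke n)"
  then show "e \<in> edges (trapezohedral_graph n)"
    using rim_arc[OF assms] spoke_arc[OF assms]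
    unfolding rim_edge_def spoke_def edges_def arcs_edges_def by blast
qed

lemma plus_graph_trapezohedral_arcs:
  assumes "n \<ge> 2"
  shows "(spoke n k, rim_edge n (Suc k)) \<in> parcs (plus_graph (trapezohedral_graph n))"
    and "(rim_edge n k, spoke n (Suc (Suc k))) \<in> parcs (plus_graph (trapezohedral_graph n))"
proof -
  interpret T: pair_graph "trapezohedral_graph n" by (rule pair_graph_trapezohedral_graph)
  note iff = parcs_plus_graph_iff[OF T.pair_wf_digraph_axioms]
  have n: "n > 0" using assms by simp
  \<comment> \<open>Moving two places keeps the parity, so both spokes of the quadrilateral end at
    the same pole.\<close>
  have pole: "pole (Suc (Suc k)) = pole k" by (simp add: pole_def)
  note arcs = rim_arc[OF n] spoke_arc[OF n] spoke_arc[OF n, of "Suc (Suc k)", unfolded pole]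
  show "(spoke n k, rim_edge n (Suc k)) \<in> parcs (plus_graph (trapezohedral_graph n))"
    unfolding iff
    by (rule exI[of _ "pole k"], rule exI[of _ "rim n k"], rule exI[of _ "rim n (Suc k)"],
        rule exI[of _ "rim n (Suc (Suc k))"])
      (use rim_distinct[OF assms, of k] arcs in \<open>simp add: spoke_def rim_edge_def\<close>)
  show "(rim_edge n k, spoke n (Suc (Suc k))) \<in> parcs (plus_graph (trapezohedral_graph n))"
    unfolding iff
    by (rule exI[of _ "rim n k"], rule exI[of _ "rim n (Suc k)"],
        rule exI[of _ "rim n (Suc (Suc k))"], rule exI[of _ "pole k"])
      (use rim_distinct[OF assms, of k] arcs in \<open>auto simp: spoke_def rim_edge_def pole\<close>)
qed

section \<open>An invariant modulo 3\<close>

text \<open>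
  Modulo 3 and for \<open>3 dvd n\<close>, the colour of an edge is \<open>k - 1\<close> for \<open>c\<^sub>k\<close> and \<open>k\<close> for \<open>s\<^sub>k\<close>. For a
  rim edge it is written as \<open>-(k + (k + 1))\<close>, which is symmetric in the indices of its ends.
\<close>

fun colour :: "trapezohedral_vertex \<Rightarrow> trapezohedral_vertex \<Rightarrow> nat" where
  "colour (A i) (B j) = i + j + 2"
| "colour (B j) (A i) = i + j + 2"
| "colour (A i) Alpha = 2 * i"
| "colour Alpha (A i) = 2 * i"
| "colour (B i) Beta = 2 * i + 1"
| "colour Beta (B i) = 2 * i + 1"
| "colour _ _ = 0"

lemma colour_commute: "colour u v = colour v u"
  by (cases u; cases v) auto

lemma A_B_arc_iff:
  "(A i, B j) \<in> parcs (trapezohedral_graph n) \<longleftrightarrow>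
    j < n \<and> (i = j \<or> i = Suc j mod n)"
  by (auto simp: trapezohedral_graph_def trapezohedral_arcs_def)

lemma trapezohedral_parcs_simps:
  "(B j, A i) \<in> parcs (trapezohedral_graph n) \<longleftrightarrow> (A i, B j) \<in> parcs (trapezohedral_graph n)"
  "(A i, A j) \<notin> parcs (trapezohedral_graph n)"
  "(B i, B j) \<notin> parcs (trapezohedral_graph n)"
  "(A i, Beta) \<notin> parcs (trapezohedral_graph n)"
  "(Beta, A i) \<notin> parcs (trapezohedral_graph n)"
  "(B i, Alpha) \<notin> parcs (trapezohedral_graph n)"
  "(Alpha, B i) \<notin> parcs (trapezohedral_graph n)"
  "(Alpha, Beta) \<notin> parcs (trapezohedral_graph n)"
  "(Beta, Alpha) \<notin> parcs (trapezohedral_graph n)"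
  by (auto simp: trapezohedral_graph_def trapezohedral_arcs_def)

text \<open>The poles are neither adjacent nor joined by a common neighbour, so a 4-cycle contains
  at most one of them. Fact \<open>A\<close> treats \<open>Alpha\<close>, fact \<open>B\<close>
  treats \<open>Beta\<close>, and \<open>AB\<close> rules out a 4-cycle inside the rim.\<close>

lemma colour_opposite:
  assumes "3 dvd n" "distinct [u, v, w, x]"
    and "{(u, v), (v, w), (w, x), (x, u)} \<subseteq> parcs (trapezohedral_graph n)"
  shows "[colour u v = colour w x] (mod 3)"
proof -
  let ?E = "parcs (trapezohedral_graph n)"
  have arc: "j < n \<and> (i = j \<or> i = Suc j mod n)" if "(A i, B j) \<in> ?E" for i j
    using that by (simp add: A_B_arc_iff)
  \<comment> \<open>Since 3 divides \<open>n\<close>, reduction modulo \<open>n\<close> preserves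
    residues modulo 3, so colours do not notice the wrap-around.\<close>
  have Suc_mod: "[Suc j mod n = Suc j] (mod 3)" for j
    using assms(1) by (simp add: cong_def mod_mod_cancel)
  have Suc_mod_add: "[Suc j mod n + c = Suc j + c] (mod 3)" for j c
    using Suc_mod by (rule cong_add) simp
  have Suc_mod_double: "[2 * (Suc j mod n) + c = 2 * Suc j + c] (mod 3)" for j c
    using Suc_mod by (intro cong_add cong_mult cong_refl)
  have add_3: "[c + 3 = c] (mod 3)" for c :: nat
    by (simp add: cong_def)
  have Suc_inj: "j = l" if "j < n" "l < n" "Suc j mod n = Suc l mod n" for j l
    using that by (simp add: mod_Suc split: if_splits)
  have no_2_cycle: "Suc (Suc j mod n) mod n \<noteq> j" for j
  proof
    assume "Suc (Suc j mod n) mod n = j"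
    then have "[j = Suc (Suc j mod n)] (mod 3)" using Suc_mod by metis
    also have "[Suc (Suc j mod n) = Suc (Suc j)] (mod 3)"
      using Suc_mod_add[of j 1] by simp
    finally have "[j + 0 = j + 2] (mod 3)" by simp
    then have "[0 = 2 :: nat] (mod 3)" unfolding cong_add_lcancel_nat .
    then show False by (simp add: cong_def)
  qed
  \<comment> \<open>The rim neighbours of \<open>B j\<close> are \<open>A j\<close> and its
    successor, so \<open>i\<close> and \<open>k\<close> are these two indices in some order.\<close>
  have A: "[2 * i = k + j + 2] (mod 3)"
    if nbrs: "(A i, B j) \<in> ?E" "(A k, B j) \<in> ?E" "i \<noteq> k" for i j k
  proof -
    consider "i = j" "k = Suc j mod n" | "k = j" "i = Suc j mod n"
      using nbrs(1,2)[THEN arc] nbrs(3) by blast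
    then show ?thesis
    proof cases
      case 1
      have "[k + (j + 2) = Suc j + (j + 2)] (mod 3)" unfolding 1 by (rule Suc_mod_add)
      also have "Suc j + (j + 2) = 2 * j + 3" by simp
      also have "[2 * j + 3 = 2 * i] (mod 3)" unfolding 1 by (rule add_3)
      finally show ?thesis by (simp add: cong_sym add.assoc)
    next
      case 2
      then show ?thesis using Suc_mod_double[of j 0] by (simp add: mult_2)
    qed
  qed
  have B: "[2 * j + 1 = i + l + 2] (mod 3)"
    if nbrs: "(A i, B j) \<in> ?E" "(A i, B l) \<in> ?E" "j \<noteq> l" for i j l
  proof -
    consider "i = j" "i = Suc l mod n" | "i = l" "i = Suc j mod n"
      using nbrs(1,2)[THEN arc] nbrs(3) Suc_inj by blast
    then show ?thesis
    proof cases
      case 1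
      then show ?thesis using Suc_mod_add[of l "i + 1"] by (simp add: mult_2 add.commute)
    next
      case 2
      have "[i + l + 2 = 2 * Suc j + 2] (mod 3)"
        using 2 Suc_mod_double[of j 2] by (simp add: mult_2)
      also have "2 * Suc j + 2 = 2 * j + 1 + 3" by simp
      also have "[2 * j + 1 + 3 = 2 * j + 1] (mod 3)" by (rule add_3)
      finally show ?thesis by (rule cong_sym)
    qed
  qed
  \<comment> \<open>Two vertices \<open>B j\<close> and \<open>B l\<close> with the same two rim
    neighbours would be successors of each other, against \<open>no_2_cycle\<close>.\<close>
  have AB: False
    if "(A i, B j) \<in> ?E" "(A k, B j) \<in> ?E" "i \<noteq> k" "(A i, B l) \<in> ?E" "(A k, B l) \<in> ?E" "j \<noteq> l"
    for i j k l
    using that(1,2,4,5)[THEN arc] that(3,6) no_2_cycle by metis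
  show ?thesis
    using assms(2,3)
    by (cases u; cases v; cases w; cases x; simp add: trapezohedral_parcs_simps)
      (use A B AB in \<open>metis cong_sym add.commute Suc_eq_plus1 add_2_eq_Suc'\<close>)+
qed

section \<open>Connectivity of the plus graph in terms of divisibility by 3\<close>

lemma connected_plus_graph:
  assumes "n \<ge> 2" "\<not> 3 dvd n"
  shows "Digraph_Component.connected (with_proj (plus_graph (trapezohedral_graph n)))"
proof -
  interpret P: pair_graph "plus_graph (trapezohedral_graph n)"
    by (intro pair_graph_plus_graph pair_graph_trapezohedral_graph)
  let ?P = "with_proj (plus_graph (trapezohedral_graph n))"
  have verts: "pverts (plus_graph (trapezohedral_graph n)) = range (rim_edge n) \<union> range (spoke n)"
    using assms(1) edges_trapezohedral_graph[of n] by (simp add: plus_graph_def)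
  have spoke_reach: "spoke n k \<rightarrow>\<^sup>*\<^bsub>?P\<^esub> rim_edge n (Suc k)" for k
    using plus_graph_trapezohedral_arcs(1)[OF assms(1)] by (intro P.reachable_adjI) simp
  have rim_step: "rim_edge n k \<rightarrow>\<^sup>*\<^bsub>?P\<^esub> rim_edge n (k + 3)" for k
  proof -
    have "rim_edge n k \<rightarrow>\<^sup>*\<^bsub>?P\<^esub> spoke n (Suc (Suc k))"
      using plus_graph_trapezohedral_arcs(2)[OF assms(1)] by (intro P.reachable_adjI) simp
    also note spoke_reach
    finally show ?thesis by (simp add: numeral_eq_Suc)
  qed
  have rim_steps: "rim_edge n k \<rightarrow>\<^sup>*\<^bsub>?P\<^esub> rim_edge n (k + 3 * m)" for k m
  proof (induction m)
    case 0
    show ?case using verts by (auto intro: P.reachable_refl)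
  next
    case (Suc m)
    note Suc.IH
    also note rim_step
    finally show ?case by (simp add: algebra_simps)
  qed
  have rim_reach: "rim_edge n 0 \<rightarrow>\<^sup>*\<^bsub>?P\<^esub> rim_edge n l" for l
  proof -
    have "prime (3 :: nat)" by simp
    then have "coprime 3 n" using assms(2) by (rule prime_imp_coprime)
    then have "coprime 3 (2 * n)" by (simp add: coprime_mult_right_iff)
    \<comment> \<open>Here \<open>y\<close> inverts 3 modulo \<open>2 * n\<close>, so
      \<open>y * l\<close> steps of length 3 lead from index 0 to index \<open>l\<close>.\<close>
    then obtain y where "[3 * y = 1] (mod 2 * n)"
      using cong_solve_coprime_nat by (metis One_nat_def)
    then have "[3 * y * l = 1 * l] (mod 2 * n)" by (rule cong_scalar_right)
    then have "[3 * (y * l) = l] (mod 2 * n)" by (simp add: mult.assoc)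
    then have "rim_edge n (0 + 3 * (y * l)) = rim_edge n l" by (simp add: rim_edge_eqI)
    then show ?thesis using rim_steps[of 0 "y * l"] by simp
  qed
  have to_base: "e \<rightarrow>\<^sup>*\<^bsub>?P\<^esub> rim_edge n 0" if "e \<in> verts ?P" for e
  proof -
    have "rim_edge n k \<rightarrow>\<^sup>*\<^bsub>?P\<^esub> rim_edge n 0" for k
      using rim_reach by (rule P.symmetric_reachable')
    then show ?thesis
      using that verts P.reachable_trans[OF spoke_reach] by auto
  qed
  \<comment> \<open>Connectedness is strong connectedness of the symmetric closure, and the arcs
    here are already symmetric.\<close>
  have "strongly_connected ?P"
  proof
    show "verts ?P \<noteq> {}" using verts by simp
    show "u \<rightarrow>\<^sup>*\<^bsub>?P\<^esub> v" if "u \<in> verts ?P" "v \<in> verts ?P" for u v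
      using to_base[OF that(1)] P.symmetric_reachable'[OF to_base[OF that(2)]]
      by (rule P.reachable_trans)
  qed
  then show ?thesis
    by (auto simp: Digraph_Component.connected_def strongly_connected_def
      P.reachable_mk_symmetric_eq P.sym_arcs)
qed

text \<open>The consecutive rim edges \<open>{A 0, B 0}\<close> and \<open>{B 0, A 1}\<close> have
  colours 2 and 3, which differ modulo 3, so no path joins them.\<close>

lemma not_connected_plus_graph:
  assumes "n \<ge> 2" "3 dvd n"
  shows "\<not> Digraph_Component.connected (with_proj (plus_graph (trapezohedral_graph n)))"
proof
  interpret T: pair_graph "trapezohedral_graph n" by (rule pair_graph_trapezohedral_graph)
  interpret P: pair_graph "plus_graph (trapezohedral_graph n)"
    by (intro pair_graph_plus_graph pair_graph_trapezohedral_graph)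
  let ?P = "with_proj (plus_graph (trapezohedral_graph n))"
  assume "Digraph_Component.connected ?P"
  then have "strongly_connected ?P"
    using P.symmetric_connected_imp_strongly_connected P.sym_arcs by blast
  moreover have "{A 0, B 0} \<in> verts ?P" "{B 0, A 1} \<in> verts ?P"
    using assms(1) by (force simp: plus_graph_def edges_def arcs_edges_def
      trapezohedral_graph_def trapezohedral_arcs_def)+
  ultimately have "{A 0, B 0} \<rightarrow>\<^sup>*\<^bsub>?P\<^esub> {B 0, A 1}" by blast
  \<comment> \<open>\<open>colour\<close> takes an ordered pair, while \<open>f\<close> is a set;
    the invariant therefore covers both orders of its ends.\<close>
  moreover have "\<forall>u v. f = {u, v} \<longrightarrow> [colour u v = 2] (mod 3)" if "{A 0, B 0} \<rightarrow>\<^sup>*\<^bsub>?P\<^esub> f" for f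
    using that
  proof (induction rule: P.reachable_induct)
    case base
    then show ?case by (auto simp: doubleton_eq_iff numeral_eq_Suc)
  next
    case (step e f)
    then have "(e, f) \<in> parcs (plus_graph (trapezohedral_graph n))" by simp
    then obtain u v w x where uvwx: "e = {u, v}" "f = {w, x}" "distinct [u, v, w, x]"
        "{(u, v), (v, w), (w, x), (x, u)} \<subseteq> parcs (trapezohedral_graph n)"
      unfolding parcs_plus_graph_iff[OF T.pair_wf_digraph_axioms] by blast
    then have "[colour w x = 2] (mod 3)"
      using colour_opposite[OF assms(2) uvwx(3,4)] step.IH by (metis cong_sym cong_trans)
    then show ?case
      using uvwx(2) by (auto simp: doubleton_eq_iff colour_commute)
  qed
  ultimately have "[colour (B 0) (A 1) = 2] (mod 3)" by blast
  then show False by (simp add: cong_def)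
qed

theorem theorem3p7:
  fixes n :: nat
  assumes "n \<ge> 2"
  shows "Digraph_Component.connected (with_proj (plus_graph (trapezohedral_graph n)))
    \<longleftrightarrow> \<not> [n = 0] (mod 3)"
  using assms connected_plus_graph not_connected_plus_graph by (auto simp: cong_0_iff)

end
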